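(* Let $\mathbb{Z}$ be endowed with the discrete topology and let $\mathcal{J}(\mathbb{Z})$ be endowed with the corresponding inverse limit topology. Then the topological group $\mathcal{J}(\mathbb{Z})$ is compressible.
   Context: $\mathcal{J}(\mathbb{Z})$ is the set of formal power series $f(x)=x(1+\alpha_1 x+\alpha_2x^2+\dots)$, $\alpha_n\in\mathbb{Z}$; it is a group under substitution $f\circ g=f(g(x))$. Its topology is the product topology transported by the bijection $\mathbb{Z}^{\aleph_0}\to\mathcal{J}(\mathbb{Z})$, $(\alpha_1,\alpha_2,\dots)\mapsto x(1+\alpha_1x+\alpha_2x^2+\dots)$, with $\mathbb{Z}$ discrete. It coincides with the inverse limit topology of the quotients $\mathcal{J}(\mathbb{Z})/\mathcal{J}_m(\mathbb{Z})$, where $\mathcal{J}_m(\mathbb{Z})=\{f:\alpha_1=\dots=\alpha_m=0\}$, and these subgroups form a base of neighborhoods of the identity. An embedding of topological groups is a continuous injective group homomorphism that is a homeomorphism onto its image. A topological group $G$ is called compressible if for any neighborhood $U\subset G$ of the identity there exists an embedding $h_U:G\to G$ with $\mathrm{Im}\,h_U\subset U$. *)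

theory Defs
  imports "HOL-Analysis.Analysis"
    "HOL-Algebra.Group" "HOL-Computational_Algebra.Formal_Power_Series"
begin

definition topological_group :: "('a, 'm) monoid_scheme \<Rightarrow> 'a topology \<Rightarrow> bool" where
  "topological_group G T \<longleftrightarrow>
     group G \<and> topspace T = carrier G \<and>
     continuous_map (prod_topology T T) T (\<lambda>(x, y). x \<otimes>\<^bsub>G\<^esub> y) \<and>
     continuous_map T T (\<lambda>x. inv\<^bsub>G\<^esub> x)"

definition topological_group_embedding ::
  "('a, 'm) monoid_scheme \<Rightarrow> 'a topology \<Rightarrow> ('b, 'n) monoid_scheme \<Rightarrow> 'b topology \<Rightarrow> ('a \<Rightarrow> 'b) \<Rightarrow> bool"
where
  "topological_group_embedding G S H T h \<longleftrightarrow>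
     h \<in> hom G H \<and> inj_on h (carrier G) \<and> continuous_map S T h \<and>
     homeomorphic_map S (subtopology T (h ` carrier G)) h"

text \<open>Neighbourhoods need not be open.\<close>

definition compressible :: "('a, 'm) monoid_scheme \<Rightarrow> 'a topology \<Rightarrow> bool" where
  "compressible G T \<longleftrightarrow>
     topological_group G T \<and>
     (\<forall>U. U \<subseteq> carrier G \<longrightarrow> (\<exists>V. openin T V \<and> \<one>\<^bsub>G\<^esub> \<in> V \<and> V \<subseteq> U) \<longrightarrow>
        (\<exists>h. topological_group_embedding G T G T h \<and> h ` carrier G \<subseteq> U))"

text \<open>The sequence of coefficients is indexed from 0 instead of 1: \<open>a k\<close> is \<open>\<alpha>\<close> with index \<open>k + 1\<close>.\<close>

definition subst_series :: "(nat \<Rightarrow> int) \<Rightarrow> int fps" where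
  "subst_series a = fps_X * (1 + fps_X * Abs_fps a)"

definition subst_group :: "int fps monoid" where
  "subst_group = \<lparr>carrier = range subst_series, mult = (\<lambda>f g. fps_compose f g), one = fps_X\<rparr>"

text \<open>The topology is transported along the bijection \<^const>\<open>subst_series\<close>, hence pulled back along
  its inverse.\<close>

definition subst_topology :: "int fps topology" where
  "subst_topology =
     pullback_topology (range subst_series) (inv_into UNIV subst_series)
       (product_topology (\<lambda>_. discrete_topology UNIV) UNIV)"

lemma subst_series_nth:
  "fps_nth (subst_series a) n = (if n = 0 then 0 else if n = 1 then 1 else a (n - 2))"
proof (cases n)
  case (Suc m)
  then show ?thesis by (cases m) (simp_all add: subst_series_def)
qed (simp add: subst_series_def)

lemma inj_subst_series: "inj subst_series"
proof (rule injI)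
  fix a b assume eq: "subst_series a = subst_series b"
  show "a = b"
  proof
    fix k
    from eq have "fps_nth (subst_series a) (k + 2) = fps_nth (subst_series b) (k + 2)" by simp
    then show "a k = b k" by (simp add: subst_series_nth)
  qed
qed

lemma range_subst_series: "range subst_series = {f. fps_nth f 0 = 0 \<and> fps_nth f 1 = 1}"
proof (intro equalityI subsetI)
  fix f :: "int fps" assume f: "f \<in> {f. fps_nth f 0 = 0 \<and> fps_nth f 1 = 1}"
  have "fps_nth f n = fps_nth (subst_series (\<lambda>k. fps_nth f (k + 2))) n" for n
  proof (cases "n = 0 \<or> n = 1")
    case True
    with f show ?thesis by (elim disjE) (simp_all add: subst_series_nth)
  next
    case False
    then have "n - 2 + 2 = n" by linarith
    with False show ?thesis by (simp only: subst_series_nth) simp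
  qed
  then have "f = subst_series (\<lambda>k. fps_nth f (k + 2))" by (rule fps_ext)
  then show "f \<in> range subst_series" by (metis rangeI)
next
  fix f :: "int fps" assume "f \<in> range subst_series"
  then obtain a where "f = subst_series a" by (rule rangeE)
  then show "f \<in> {f. fps_nth f 0 = 0 \<and> fps_nth f 1 = 1}" by (simp add: subst_series_nth)
qed

lemma homeomorphic_map_subst_series:
  "homeomorphic_map (product_topology (\<lambda>_. discrete_topology UNIV) UNIV) subst_topology subst_series"
proof -
  let ?P = "product_topology (\<lambda>_. discrete_topology UNIV) UNIV :: (nat \<Rightarrow> int) topology"
  let ?i = "inv_into UNIV subst_series"
  have i: "?i (subst_series a) = a" for a by (rule inv_f_f[OF inj_subst_series])
  have top: "topspace subst_topology = range subst_series"
    by (simp add: subst_topology_def topspace_pullback_topology)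
  have id: "?i \<circ> subst_series = id" by (simp add: fun_eq_iff i)
  have "continuous_map ?P subst_topology subst_series"
    unfolding subst_topology_def by (rule continuous_map_pullback') (simp only: id continuous_map_id, blast)
  moreover have "continuous_map subst_topology ?P (id \<circ> ?i)"
    unfolding subst_topology_def by (rule continuous_map_pullback) (rule continuous_map_id)
  ultimately have "homeomorphic_maps ?P subst_topology subst_series ?i"
    unfolding homeomorphic_maps_def top by (simp add: i f_inv_into_f)
  then show ?thesis using homeomorphic_map_maps by blast
qed

end

theory Submission
  imports Defs
begin

text \<open>Let \<open>J\<close> be the substitution group and \<open>Y = m^2 X^m\<close> with \<open>m \<ge> 1\<close>. Conjugation by the noninvertible
  substitution \<open>Y\<close> turns \<open>f \<in> J\<close> into the series \<open>g\<close> with \<open>Y oo g = f oo Y\<close>, that is,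
  \<open>m^2 g^m = f (m^2 X^m)\<close>. This equation has exactly one solution \<open>g\<close> in \<open>J\<close>. Uniqueness is
  cancellation of \<open>Y\<close> on the left; it makes the map from \<open>f\<close> to \<open>g\<close> a homomorphism, since
  \<open>Y oo g1 oo g2 = f1 oo Y oo g2 = f1 oo f2 oo Y\<close>.

  Existence (\<open>ramified_conjugate_exists\<close>) amounts to an \<open>m\<close>-th root with integer coefficients of a
  series \<open>1 + m^2 u\<close>. The factor \<open>m^2\<close> makes the root integral: \<open>(1 + m X)^m = 1 + m^2 p\<close> with
  \<open>p \<in> J\<close>, so a root is \<open>1 + m (q oo u)\<close>, where \<open>q\<close> is the inverse of \<open>p\<close> in \<open>J\<close>.

  The map is a rescaled isometry: counting orders of vanishing shows that \<open>f1\<close> and \<open>f2\<close> agree up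
  to degree \<open>n\<close> if and only if their images agree up to degree \<open>m n\<close>
  (\<open>agree_ramified_conjugate_iff\<close>). As the topology is given by agreement up to a degree
  (\<open>openin_subst_topology\<close>), this one equivalence yields injectivity, continuity, and continuity of
  the inverse on the image. It also bounds the image: every element of \<open>J\<close> agrees with the identity
  up to degree 1, so every element of the image agrees with it up to degree \<open>m\<close>, and \<open>m\<close> can be
  chosen as large as a given neighbourhood demands.\<close>

section \<open>Congruence of power series\<close>

definition agree :: "nat \<Rightarrow> 'a::zero fps \<Rightarrow> 'a fps \<Rightarrow> bool" where
  "agree n f g \<longleftrightarrow> (\<forall>i\<le>n. fps_nth f i = fps_nth g i)"

lemma agree_refl [simp]: "agree n f f"
  by (simp add: agree_def)

lemma agree_sym: "agree n f g \<Longrightarrow> agree n g f"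
  by (simp add: agree_def)

lemma agree_mono: "agree n f g \<Longrightarrow> m \<le> n \<Longrightarrow> agree m f g"
  by (simp add: agree_def)

lemma agree_iff_subdegree:
  fixes f g :: "'a::ab_group_add fps"
  shows "agree n f g \<longleftrightarrow> f = g \<or> n < subdegree (f - g)"
proof
  assume a: "agree n f g"
  show "f = g \<or> n < subdegree (f - g)"
  proof (cases "f = g")
    case False
    then have "n < subdegree (f - g)"
      using a by (intro subdegree_greaterI) (auto simp: agree_def)
    then show ?thesis ..
  qed simp
next
  assume "f = g \<or> n < subdegree (f - g)"
  then show "agree n f g"
  proof
    assume "n < subdegree (f - g)"
    then have "fps_nth (f - g) i = 0" if "i \<le> n" for i
      using that by (intro nth_less_subdegree_zero) simp
    then show ?thesis by (simp add: agree_def)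
  qed simp
qed

lemma agree_mult:
  "agree n f f' \<Longrightarrow> agree n g g' \<Longrightarrow> agree n (f * g) (f' * g' :: 'a::semiring_1 fps)"
  by (auto simp: agree_def fps_mult_nth intro!: sum.cong)

lemma agree_power: "agree n f f' \<Longrightarrow> agree n (f ^ k) (f' ^ k :: 'a::semiring_1 fps)"
  by (induction k) (simp_all add: agree_mult)

lemma agree_compose:
  "agree n f f' \<Longrightarrow> agree n g g' \<Longrightarrow> agree n (f oo g) (f' oo g')"
  using agree_power[of n g g']
  by (auto simp: agree_def fps_compose_nth intro!: sum.cong)

section \<open>The substitution group\<close>

lemma carrier_subst_group:
  "carrier subst_group = {f. fps_nth f 0 = 0 \<and> fps_nth f 1 = 1}"
  by (simp add: subst_group_def range_subst_series)

lemma mult_subst_group [simp]: "f \<otimes>\<^bsub>subst_group\<^esub> g = f oo g"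
  by (simp add: subst_group_def)

lemma one_subst_group [simp]: "\<one>\<^bsub>subst_group\<^esub> = fps_X"
  by (simp add: subst_group_def)

lemma one_in_carrier: "fps_X \<in> carrier subst_group"
  by (simp add: carrier_subst_group)

lemma compose_in_carrier:
  assumes "f \<in> carrier subst_group" "g \<in> carrier subst_group"
  shows "f oo g \<in> carrier subst_group"
  using assms by (simp add: carrier_subst_group fps_compose_nth)

text \<open>Coefficient \<open>n\<close> of the equation \<open>g oo f = X\<close> involves only \<open>g_0, ..., g_n\<close>, and its factor of \<open>g_n\<close>
  is the coefficient of \<open>X^n\<close> in \<open>f^n\<close>, which is 1 when \<open>f = X + ...\<close>; so the equation can be solved for \<open>g_n\<close>
  without division.\<close>

fun left_inverse_coeff :: "'a::comm_ring_1 fps \<Rightarrow> nat \<Rightarrow> 'a" where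
  "left_inverse_coeff f n =
     fps_nth fps_X n - (\<Sum>i<n. left_inverse_coeff f i * fps_nth (f ^ i) n)"

declare left_inverse_coeff.simps [simp del]

lemma left_inverse_compose:
  assumes "fps_nth f 0 = 0" "fps_nth f 1 = (1 :: 'a::idom)"
  shows "Abs_fps (left_inverse_coeff f) oo f = fps_X"
proof (rule fps_ext)
  fix n
  let ?c = "left_inverse_coeff f"
  have "fps_nth (Abs_fps ?c oo f) n = (\<Sum>i<Suc n. ?c i * fps_nth (f ^ i) n)"
    by (simp add: fps_compose_nth atLeast0AtMost lessThan_Suc_atMost)
  also have "\<dots> = (\<Sum>i<n. ?c i * fps_nth (f ^ i) n) + ?c n"
    using startsby_zero_power_nth_same[OF assms(1), of n] assms(2) by simp
  also have "\<dots> = fps_nth fps_X n"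
    by (simp add: left_inverse_coeff.simps[of f n])
  finally show "fps_nth (Abs_fps ?c oo f) n = fps_nth fps_X n" .
qed

lemma group_subst_group: "group subst_group"
proof (rule groupI)
  fix f assume f: "f \<in> carrier subst_group"
  let ?g = "Abs_fps (left_inverse_coeff f)"
  have "?g \<in> carrier subst_group"
    using f by (simp add: carrier_subst_group left_inverse_coeff.simps[of f 0]
        left_inverse_coeff.simps[of f "Suc 0"])
  moreover have "?g oo f = fps_X"
    using f by (intro left_inverse_compose) (simp_all add: carrier_subst_group)
  ultimately show "\<exists>g\<in>carrier subst_group. g \<otimes>\<^bsub>subst_group\<^esub> f = \<one>\<^bsub>subst_group\<^esub>"
    by auto
next
  fix f g h assume "f \<in> carrier subst_group" "g \<in> carrier subst_group" "h \<in> carrier subst_group"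
  then show "f \<otimes>\<^bsub>subst_group\<^esub> g \<otimes>\<^bsub>subst_group\<^esub> h = f \<otimes>\<^bsub>subst_group\<^esub> (g \<otimes>\<^bsub>subst_group\<^esub> h)"
    by (simp add: carrier_subst_group fps_compose_assoc)
qed (simp_all add: compose_in_carrier one_in_carrier, simp add: carrier_subst_group)

interpretation J: group subst_group
  by (rule group_subst_group)

text \<open>Composition respects agreement, so \<open>inv f oo f oo inv g\<close> and \<open>inv f oo g oo inv g\<close> agree as far
  as \<open>f\<close> and \<open>g\<close> do; no recursion for the coefficients of the inverse has to be inspected.\<close>

lemma agree_inv:
  assumes f: "f \<in> carrier subst_group" and g: "g \<in> carrier subst_group" and fg: "agree n f g"
  shows "agree n (inv\<^bsub>subst_group\<^esub> f) (inv\<^bsub>subst_group\<^esub> g)"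
proof -
  let ?f = "inv\<^bsub>subst_group\<^esub> f" and ?g = "inv\<^bsub>subst_group\<^esub> g"
  have "agree n (?f oo (f oo ?g)) (?f oo (g oo ?g))"
    by (intro agree_compose agree_refl fg)
  moreover have "?f oo (f oo ?g) = ?g"
    using f g
    by (metis J.inv_closed J.l_inv J.l_one J.m_assoc mult_subst_group)
  moreover have "?f oo (g oo ?g) = ?f"
    using J.r_inv[OF g] J.r_one[OF J.inv_closed[OF f]] by simp
  ultimately show ?thesis by (simp add: agree_sym)
qed

section \<open>The topology\<close>

lemma topspace_subst_topology [simp]: "topspace subst_topology = carrier subst_group"
  by (simp add: subst_topology_def topspace_pullback_topology subst_group_def)

lemma openin_agree_ball:
  "openin subst_topology {g \<in> carrier subst_group. agree n f g}"
proof -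
  let ?P = "product_topology (\<lambda>_. discrete_topology UNIV) UNIV :: (nat \<Rightarrow> int) topology"
  let ?W = "{a. agree n f (subst_series a)}"
  have "openin ?P ?W"
  proof (cases "fps_nth f 0 = 0 \<and> (1 \<le> n \<longrightarrow> fps_nth f 1 = 1)")
    case True
    then have "?W = (\<Pi>\<^sub>E k\<in>UNIV. if k + 2 \<le> n then {fps_nth f (k + 2)} else UNIV)"
      (is "_ = PiE UNIV ?S")
    proof (intro equalityI subsetI)
      fix a assume "a \<in> ?W"
      then have "a k = fps_nth f (k + 2)" if "k + 2 \<le> n" for k
        using that by (auto simp: agree_def subst_series_nth dest!: spec[of _ "k + 2"])
      then show "a \<in> PiE UNIV ?S" by (auto simp: PiE_iff)
    next
      fix a assume a: "a \<in> PiE UNIV ?S"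
      have "fps_nth f i = fps_nth (subst_series a) i" if "i \<le> n" for i
      proof (cases "i < 2")
        case False
        then have "a (i - 2) \<in> ?S (i - 2)" and "i - 2 + 2 = i" using a by (auto simp: PiE_iff)
        then show ?thesis using that False by (simp add: subst_series_nth)
      qed (use True that in \<open>auto simp: subst_series_nth less_2_cases_iff\<close>)
      then show "a \<in> ?W" by (simp add: agree_def)
    qed
    moreover have "finite {k. ?S k \<noteq> UNIV}"
      by (rule finite_subset[of _ "{..n}"]) auto
    ultimately show ?thesis by (simp add: openin_PiE_gen)
  next
    case False
    then have "?W = {}" by (auto simp: agree_def subst_series_nth)
    then show ?thesis by simp
  qed
  then have "openin subst_topology (subst_series ` ?W)"
    using homeomorphic_map_openness[OF homeomorphic_map_subst_series, of ?W] by simp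
  also have "subst_series ` ?W = {g \<in> carrier subst_group. agree n f g}"
    by (auto simp: subst_group_def)
  finally show ?thesis .
qed

lemma openin_subst_topology:
  "openin subst_topology V \<longleftrightarrow>
     V \<subseteq> carrier subst_group \<and>
     (\<forall>f\<in>V. \<exists>n. \<forall>g\<in>carrier subst_group. agree n f g \<longrightarrow> g \<in> V)"
proof
  assume V: "openin subst_topology V"
  then have sub: "V \<subseteq> carrier subst_group" using openin_subset by fastforce
  let ?P = "product_topology (\<lambda>_. discrete_topology UNIV) UNIV :: (nat \<Rightarrow> int) topology"
  define W where "W = subst_series -` V"
  have "V = subst_series ` W" using sub by (auto simp: W_def subst_group_def)
  with V have W: "openin ?P W"
    using homeomorphic_map_openness[OF homeomorphic_map_subst_series, of W] by simp
  have "\<exists>n. \<forall>g\<in>carrier subst_group. agree n f g \<longrightarrow> g \<in> V" if "f \<in> V" for f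
  proof -
    from that sub obtain a where f: "f = subst_series a" by (auto simp: subst_group_def)
    with that have "a \<in> W" by (simp add: W_def)
    from product_topology_open_contains_basis[OF W this] obtain X where
      X: "a \<in> PiE UNIV X" "finite {i. X i \<noteq> UNIV}" "PiE UNIV X \<subseteq> W" by auto
    from finite_nat_set_iff_bounded[THEN iffD1, OF X(2)] obtain N
      where N: "\<And>i. X i \<noteq> UNIV \<Longrightarrow> i < N" by auto
    have "g \<in> V" if g: "g \<in> carrier subst_group" "agree (N + 2) f g" for g
    proof -
      from g(1) obtain b where b: "g = subst_series b" by (auto simp: subst_group_def)
      have "b i = a i" if "i < N" for i
        using g(2) that by (auto simp: agree_def f b subst_series_nth dest!: spec[of _ "i + 2"])
      then have "b \<in> PiE UNIV X" using X(1) N by (fastforce simp: PiE_iff)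
      with X(3) show ?thesis by (auto simp: W_def b)
    qed
    then show ?thesis by blast
  qed
  with sub show "V \<subseteq> carrier subst_group \<and>
     (\<forall>f\<in>V. \<exists>n. \<forall>g\<in>carrier subst_group. agree n f g \<longrightarrow> g \<in> V)" by blast
next
  assume V: "V \<subseteq> carrier subst_group \<and>
     (\<forall>f\<in>V. \<exists>n. \<forall>g\<in>carrier subst_group. agree n f g \<longrightarrow> g \<in> V)"
  show "openin subst_topology V"
  proof (subst openin_subopen, rule ballI)
    fix f assume f: "f \<in> V"
    with V obtain n where "\<forall>g\<in>carrier subst_group. agree n f g \<longrightarrow> g \<in> V" by blast
    with f V show "\<exists>T. openin subst_topology T \<and> f \<in> T \<and> T \<subseteq> V"
      by (intro exI[of _ "{g \<in> carrier subst_group. agree n f g}"]) (auto simp: openin_agree_ball)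
  qed
qed

lemma continuous_map_subst_topologyI:
  assumes "\<And>f. f \<in> carrier subst_group \<Longrightarrow> h f \<in> carrier subst_group"
    and "\<And>n f g. f \<in> carrier subst_group \<Longrightarrow> g \<in> carrier subst_group \<Longrightarrow> agree n f g
           \<Longrightarrow> agree n (h f) (h g)"
  shows "continuous_map subst_topology subst_topology h"
  unfolding continuous_map topspace_subst_topology
proof (intro conjI allI impI)
  fix V assume "openin subst_topology V"
  with assms show "openin subst_topology {x \<in> carrier subst_group. h x \<in> V}"
    unfolding openin_subst_topology by (auto, meson)
qed (use assms(1) in auto)

lemma topological_group_subst_group: "topological_group subst_group subst_topology"
  unfolding topological_group_def
proof (intro conjI)
  show "continuous_map subst_topology subst_topology (\<lambda>x. inv\<^bsub>subst_group\<^esub> x)"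
    by (rule continuous_map_subst_topologyI) (simp_all add: agree_inv)
  show "continuous_map (prod_topology subst_topology subst_topology) subst_topology
          (\<lambda>(x, y). x \<otimes>\<^bsub>subst_group\<^esub> y)"
    unfolding continuous_map
  proof (intro conjI allI impI)
    fix V assume V: "openin subst_topology V"
    show "openin (prod_topology subst_topology subst_topology)
      {p \<in> topspace (prod_topology subst_topology subst_topology).
         (case p of (x, y) \<Rightarrow> x \<otimes>\<^bsub>subst_group\<^esub> y) \<in> V}" (is "openin _ ?S")
      unfolding openin_prod_topology_alt
    proof (intro allI impI)
      fix f g assume "(f, g) \<in> ?S"
      then have fg: "f \<in> carrier subst_group" "g \<in> carrier subst_group" "f oo g \<in> V" by auto
      with V obtain n where
        n: "\<And>k. k \<in> carrier subst_group \<Longrightarrow> agree n (f oo g) k \<Longrightarrow> k \<in> V"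
        unfolding openin_subst_topology by blast
      let ?B = "\<lambda>f. {f' \<in> carrier subst_group. agree n f f'}"
      have "?B f \<times> ?B g \<subseteq> ?S"
        by (auto intro!: n compose_in_carrier agree_compose)
      with fg show "\<exists>U W. openin subst_topology U \<and> openin subst_topology W \<and>
          f \<in> U \<and> g \<in> W \<and> U \<times> W \<subseteq> ?S"
        by (intro exI[of _ "?B f"] exI[of _ "?B g"]) (simp add: openin_agree_ball)
    qed
  qed (auto simp: compose_in_carrier)
qed (simp_all add: group_subst_group)

text \<open>Balls of degree \<open>m n\<close> around points of the image pull back exactly to balls of degree \<open>n\<close>. Such
  balls still form a neighbourhood base of each point, so the image carries the topology of the source.\<close>

lemma topological_group_embeddingI:
  assumes hom: "h \<in> hom subst_group subst_group" and m: "m \<ge> 1"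
    and agree: "\<And>n f g. f \<in> carrier subst_group \<Longrightarrow> g \<in> carrier subst_group \<Longrightarrow>
                  agree (m * n) (h f) (h g) \<longleftrightarrow> agree n f g"
  shows "topological_group_embedding subst_group subst_topology subst_group subst_topology h"
proof -
  let ?C = "carrier subst_group"
  have closed: "h f \<in> ?C" if "f \<in> ?C" for f
    using hom_in_carrier[OF hom that] .
  have inj: "inj_on h ?C"
  proof (rule inj_onI)
    fix f g assume fg: "f \<in> ?C" "g \<in> ?C" "h f = h g"
    then have "agree n f g" for n by (simp flip: agree)
    then show "f = g" by (auto simp: fps_eq_iff agree_def)
  qed
  have cont: "continuous_map subst_topology subst_topology h"
  proof (rule continuous_map_subst_topologyI)
    fix n f g assume "f \<in> ?C" "g \<in> ?C" "agree n f g"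
    then have "agree (m * n) (h f) (h g)" by (simp add: agree)
    then show "agree n (h f) (h g)" by (rule agree_mono) (use m in simp)
  qed (rule closed)
  let ?S = "subtopology subst_topology (h ` ?C)"
  have top: "topspace ?S = h ` ?C" using closed by auto
  have "open_map subst_topology ?S h"
    unfolding open_map_def
  proof (intro allI impI)
    fix U assume U: "openin subst_topology U"
    then have UC: "U \<subseteq> ?C" by (simp add: openin_subst_topology)
    show "openin ?S (h ` U)"
    proof (subst openin_subopen, rule ballI)
      fix k assume "k \<in> h ` U"
      then obtain f where f: "f \<in> U" "k = h f" by blast
      with U obtain n where n: "\<And>g. g \<in> ?C \<Longrightarrow> agree n f g \<Longrightarrow> g \<in> U"
        unfolding openin_subst_topology by blast
      let ?B = "{k' \<in> ?C. agree (m * n) k k'}"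
      have "openin ?S (?B \<inter> h ` ?C)"
        by (intro openin_subtopology_Int openin_agree_ball)
      moreover have "k \<in> ?B \<inter> h ` ?C" using f UC closed by auto
      moreover have "?B \<inter> h ` ?C \<subseteq> h ` U"
        using f UC agree n by auto
      ultimately show "\<exists>T. openin ?S T \<and> k \<in> T \<and> T \<subseteq> h ` U" by blast
    qed
  qed
  moreover have "continuous_map subst_topology ?S h"
    using cont by (auto intro: continuous_map_into_subtopology)
  ultimately have "homeomorphic_map subst_topology ?S h"
    by (intro bijective_open_imp_homeomorphic_map) (simp_all only: top topspace_subst_topology inj)
  with hom inj cont show ?thesis
    by (simp add: topological_group_embedding_def)
qed

section \<open>Conjugation by a ramified substitution\<close>

text \<open>As a self-map of the line, this is the \<open>m\<close>-fold cover totally ramified at the origin, scaled by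
  the factor that makes conjugation by it preserve integrality.\<close>

definition power_cover :: "nat \<Rightarrow> int fps" where
  "power_cover m = of_nat (m ^ 2) * fps_X ^ m"

lemma power_cover_nth_0: "m \<ge> 1 \<Longrightarrow> fps_nth (power_cover m) 0 = 0"
  by (simp add: power_cover_def)

lemma subdegree_power_cover: "m \<ge> 1 \<Longrightarrow> subdegree (power_cover m) = m"
  by (simp add: power_cover_def fps_X_power_subdegree)

lemma of_nat_compose: "of_nat k oo (f :: 'a::comm_ring_1 fps) = of_nat k"
  by (metis fps_const_compose fps_of_nat)

lemma power_cover_compose:
  "fps_nth g 0 = 0 \<Longrightarrow> power_cover m oo g = of_nat (m ^ 2) * g ^ m"
  by (simp add: power_cover_def fps_compose_mult_distrib of_nat_compose flip: fps_compose_power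
      del: of_nat_power)

text \<open>Composition with a series of order \<open>m\<close> multiplies the order of a difference by \<open>m\<close>. A difference
  of order at least \<open>n + 1\<close> becomes one of order at least \<open>m (n + 1)\<close>, which is where the degree
  \<open>m n + m - 1\<close> comes from.\<close>

lemma agree_compose_power_cover_iff:
  assumes m: "m \<ge> 1"
  shows "agree (m * n + m - 1) (f oo power_cover m) (g oo power_cover m) \<longleftrightarrow> agree n f g"
proof -
  note r0 = power_cover_nth_0[OF m]
  have nz: "power_cover m \<noteq> 0" using subdegree_power_cover[OF m] m by auto
  have "(f oo power_cover m) - (g oo power_cover m) = (f - g) oo power_cover m"
    by (simp add: fps_compose_sub_distrib)
  moreover have "f oo power_cover m = g oo power_cover m \<longleftrightarrow> f = g"
    using fps_compose_eq_0_iff[OF r0, of "f - g"] nz by (simp add: fps_compose_sub_distrib)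
  moreover have "m * n + m - 1 < s * m \<longleftrightarrow> n < s" for s
  proof -
    have "m * n + m - 1 < s * m \<longleftrightarrow> Suc n * m \<le> s * m" using m by (auto simp: algebra_simps)
    also have "\<dots> \<longleftrightarrow> n < s" using m by (subst mult_le_cancel2) auto
    finally show ?thesis .
  qed
  ultimately show ?thesis
    by (simp add: agree_iff_subdegree subdegree_fps_compose r0 subdegree_power_cover[OF m])
qed

text \<open>The quotient of \<open>f^m - g^m\<close> by \<open>f - g\<close> is a sum of \<open>m\<close> products of \<open>m - 1\<close> series of the form \<open>X + ...\<close>,
  hence \<open>m X^(m - 1) + ...\<close>. As \<open>m\<close> is nonzero, the order of the difference grows by exactly \<open>m - 1\<close>.\<close>

lemma agree_power_cover_compose_iff:
  assumes m: "m \<ge> 1" and f: "f \<in> carrier subst_group" and g: "g \<in> carrier subst_group"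
  shows "agree (n + m - 1) (power_cover m oo f) (power_cover m oo g) \<longleftrightarrow> agree n f g"
proof -
  define a where "a = fps_shift 1 f"
  define b where "b = fps_shift 1 g"
  have fa: "f = fps_X * a" and gb: "g = fps_X * b"
    using f g by (auto simp: a_def b_def carrier_subst_group fps_eq_iff)
  have ab0: "fps_nth a 0 = 1" "fps_nth b 0 = 1"
    using f g by (simp_all add: a_def b_def carrier_subst_group)
  define s where "s = (\<Sum>i<m. b ^ (m - Suc i) * a ^ i)"
  have s0: "fps_nth s 0 = int m"
    by (simp add: s_def fps_sum_nth fps_nth_power_0 ab0)
  have "(power_cover m oo f) - (power_cover m oo g) = of_nat (m ^ 2) * (fps_X ^ m * (a ^ m - b ^ m))"
    using f g by (simp add: carrier_subst_group power_cover_compose fa gb power_mult_distrib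
      algebra_simps del: of_nat_power)
  also have "\<dots> = (f - g) * (of_nat (m ^ 2) * fps_X ^ (m - 1) * s)"
  proof -
    have X: "fps_X ^ m = fps_X * (fps_X ^ (m - 1) :: int fps)"
      using m by (metis One_nat_def Suc_pred less_eq_Suc_le power_Suc)
    show ?thesis
      unfolding power_diff_sumr2 s_def[symmetric] fa gb X
      by (simp only: right_diff_distrib left_diff_distrib ac_simps)
  qed
  finally have eq: "(power_cover m oo f) - (power_cover m oo g) = (f - g) * (of_nat (m ^ 2) * fps_X ^ (m - 1) * s)" .
  have s: "s \<noteq> 0" "subdegree s = 0" using s0 m by (auto simp: subdegree_eq_0_iff)
  let ?q = "of_nat (m ^ 2) * fps_X ^ (m - 1) * s"
  have q: "?q \<noteq> 0" "subdegree ?q = m - 1"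
    using m s by (simp_all add: fps_X_power_subdegree)
  have "power_cover m oo f = power_cover m oo g \<longleftrightarrow> f = g"
    using eq q by (metis eq_iff_diff_eq_0 mult_eq_0_iff)
  moreover have "subdegree ((power_cover m oo f) - (power_cover m oo g)) = subdegree (f - g) + (m - 1)" if "f \<noteq> g"
    unfolding eq using that q by (subst subdegree_mult) auto
  ultimately show ?thesis using m by (auto simp: agree_iff_subdegree)
qed

text \<open>For \<open>n = c = m\<close> the linear term also carries the factor \<open>m^2\<close>; this is the source of the integral
  \<open>m\<close>-th root.\<close>

lemma one_plus_power_expansion:
  "\<exists>q. (1 + c * x) ^ n = 1 + of_nat n * c * x + c\<^sup>2 * x\<^sup>2 * (q :: 'a::comm_ring_1)"
proof (induction n)
  case 0
  show ?case by (rule exI[of _ 0]) simp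
next
  case (Suc n)
  then obtain q where q: "(1 + c * x) ^ n = 1 + of_nat n * c * x + c\<^sup>2 * x\<^sup>2 * q" by blast
  show ?case
    by (rule exI[of _ "of_nat n + q + c * x * q"])
      (simp only: power_Suc q, simp add: algebra_simps power2_eq_square)
qed

lemma ramified_conjugate_exists:
  assumes m: "m \<ge> 1" and f: "f \<in> carrier subst_group"
  shows "\<exists>g\<in>carrier subst_group. power_cover m oo g = f oo power_cover m"
proof -
  let ?M = "of_nat m :: int fps" and ?Y = "power_cover m"
  obtain q where q: "(1 + ?M * fps_X) ^ m = 1 + of_nat m * ?M * fps_X + ?M\<^sup>2 * fps_X\<^sup>2 * q"
    using one_plus_power_expansion by blast
  define p where "p = fps_X + fps_X\<^sup>2 * q"
  have p: "p \<in> carrier subst_group"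
    by (simp add: carrier_subst_group p_def fps_X_power_mult_nth)
  have power_p: "(1 + ?M * fps_X) ^ m = 1 + ?M\<^sup>2 * p"
    unfolding q p_def by (simp add: algebra_simps power2_eq_square)
  \<comment> \<open>In \<open>f oo Y = Y + Y^2 (a oo Y)\<close> the last term carries \<open>m^4\<close>, which leaves \<open>m^2\<close> after removal of \<open>Y\<close>.\<close>
  define a where "a = fps_shift 2 f"
  have fa: "f = fps_X + fps_X\<^sup>2 * a"
  proof (rule fps_ext)
    fix n show "fps_nth f n = fps_nth (fps_X + fps_X\<^sup>2 * a) n"
    proof (cases "n < 2")
      case False
      then have "n - 2 + 2 = n" by simp
      with False show ?thesis
        by (simp only: a_def fps_add_nth fps_X_power_mult_nth fps_shift_nth) simp
    qed (use f in \<open>auto simp: carrier_subst_group a_def fps_X_power_mult_nth less_2_cases_iff\<close>)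
  qed
  define u where "u = fps_X ^ m * (a oo ?Y)"
  have u0: "fps_nth u 0 = 0" using m by (simp add: u_def)
  have fY: "f oo ?Y = ?Y * (1 + ?M\<^sup>2 * u)"
  proof -
    have "f oo ?Y = ?Y + ?Y ^ 2 * (a oo ?Y)"
      using power_cover_nth_0[OF m]
      by (simp add: fa fps_compose_add_distrib fps_compose_mult_distrib flip: fps_compose_power)
    also have "\<dots> = ?Y * (1 + ?M\<^sup>2 * u)"
      by (simp add: u_def power_cover_def algebra_simps power2_eq_square)
    finally show ?thesis .
  qed
  \<comment> \<open>The root of \<open>1 + m^2 u\<close> is sought as \<open>1 + m w\<close>, which requires \<open>p oo w = u\<close>.\<close>
  let ?p' = "inv\<^bsub>subst_group\<^esub> p"
  define w where "w = ?p' oo u"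
  have p': "?p' \<in> carrier subst_group" using p by simp
  have w0: "fps_nth w 0 = 0" using p' by (simp add: w_def carrier_subst_group)
  have "p oo w = (p oo ?p') oo u"
    unfolding w_def using u0 p' by (subst fps_compose_assoc) (simp_all add: carrier_subst_group)
  then have pw: "p oo w = u" using J.r_inv[OF p] u0 by simp
  have "(1 + ?M * w) ^ m = (1 + ?M * fps_X) ^ m oo w"
    using w0 by (simp add: fps_compose_add_distrib fps_compose_mult_distrib of_nat_compose
      flip: fps_compose_power)
  also have "\<dots> = 1 + ?M\<^sup>2 * u"
    unfolding power_p
    using w0 by (simp add: fps_compose_add_distrib fps_compose_mult_distrib of_nat_compose pw
      flip: fps_compose_power)
  finally have root: "(1 + ?M * w) ^ m = 1 + ?M\<^sup>2 * u" .
  define g where "g = fps_X * (1 + ?M * w)"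
  have g: "g \<in> carrier subst_group"
    by (simp add: carrier_subst_group g_def w0)
  moreover have "?Y oo g = f oo ?Y"
    using g by (simp add: power_cover_compose carrier_subst_group fY)
      (simp add: g_def power_mult_distrib root power_cover_def mult.assoc)
  ultimately show ?thesis by blast
qed

definition ramified_conjugate :: "nat \<Rightarrow> int fps \<Rightarrow> int fps" where
  "ramified_conjugate m f = (SOME g. g \<in> carrier subst_group \<and> power_cover m oo g = f oo power_cover m)"

lemma ramified_conjugate:
  assumes "m \<ge> 1" "f \<in> carrier subst_group"
  shows "ramified_conjugate m f \<in> carrier subst_group"
    and "power_cover m oo ramified_conjugate m f = f oo power_cover m"
  using someI_ex[OF ramified_conjugate_exists[OF assms, unfolded Bex_def]]
  unfolding ramified_conjugate_def by blast+

text \<open>Composing with the cover on the right takes agreement in degree \<open>n\<close> to degree \<open>m n + m - 1\<close>, and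
  removing it on the left takes this to degree \<open>m n\<close>.\<close>

lemma agree_ramified_conjugate_iff:
  assumes m: "m \<ge> 1" and f: "f \<in> carrier subst_group" and g: "g \<in> carrier subst_group"
  shows "agree (m * n) (ramified_conjugate m f) (ramified_conjugate m g) \<longleftrightarrow> agree n f g"
  using agree_power_cover_compose_iff[OF m ramified_conjugate(1)[OF m f] ramified_conjugate(1)[OF m g],
      of "m * n"]
    agree_compose_power_cover_iff[OF m, of n f g] m f g
  by (simp add: ramified_conjugate(2))

lemma power_cover_compose_cancel:
  assumes "m \<ge> 1" "f \<in> carrier subst_group" "g \<in> carrier subst_group"
    and "power_cover m oo f = power_cover m oo g"
  shows "f = g"
proof (rule fps_ext)
  fix n
  have "agree n f g" using agree_power_cover_compose_iff[OF assms(1-3), of n] assms(4) by simp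
  then show "fps_nth f n = fps_nth g n" by (simp add: agree_def)
qed

lemma ramified_conjugate_hom:
  assumes m: "m \<ge> 1"
  shows "ramified_conjugate m \<in> hom subst_group subst_group"
proof (rule homI)
  fix f g assume f: "f \<in> carrier subst_group" and g: "g \<in> carrier subst_group"
  let ?h = "ramified_conjugate m" and ?Y = "power_cover m"
  note hf = ramified_conjugate[OF m f] and hg = ramified_conjugate[OF m g]
  note fg = compose_in_carrier[OF f g]
  have z: "fps_nth g 0 = 0" "fps_nth (?h f) 0 = 0" "fps_nth (?h g) 0 = 0" "fps_nth ?Y 0 = 0"
    using g hf(1) hg(1) power_cover_nth_0[OF m] by (simp_all add: carrier_subst_group)
  have "?Y oo (?h f oo ?h g) = (f oo ?Y) oo ?h g"
    using z hf(2) by (simp add: fps_compose_assoc)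
  also have "\<dots> = f oo (g oo ?Y)"
    using z hg(2) by (simp flip: fps_compose_assoc)
  also have "\<dots> = ?Y oo ?h (f oo g)"
    using z ramified_conjugate(2)[OF m fg] by (simp add: fps_compose_assoc)
  finally have "?h f oo ?h g = ?h (f oo g)"
    by (rule power_cover_compose_cancel[OF m compose_in_carrier[OF hf(1) hg(1)] ramified_conjugate(1)[OF m fg]])
  then show "?h (f \<otimes>\<^bsub>subst_group\<^esub> g) = ?h f \<otimes>\<^bsub>subst_group\<^esub> ?h g" by simp
qed (rule ramified_conjugate(1)[OF m])

section \<open>Compressibility\<close>

theorem mainTheorem3: "compressible subst_group subst_topology"
  unfolding compressible_def
proof (intro conjI allI impI)
  show "topological_group subst_group subst_topology" by (rule topological_group_subst_group)
next
  fix U assume "\<exists>V. openin subst_topology V \<and> \<one>\<^bsub>subst_group\<^esub> \<in> V \<and> V \<subseteq> U"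
  then obtain V where "openin subst_topology V" "fps_X \<in> V" and VU: "V \<subseteq> U"
    unfolding one_subst_group by blast
  then obtain n where n: "\<And>g. g \<in> carrier subst_group \<Longrightarrow> agree n fps_X g \<Longrightarrow> g \<in> V"
    unfolding openin_subst_topology by blast
  let ?h = "ramified_conjugate (Suc n)"
  have m: "Suc n \<ge> 1" by simp
  have "topological_group_embedding subst_group subst_topology subst_group subst_topology ?h"
    by (rule topological_group_embeddingI[OF ramified_conjugate_hom[OF m] m
        agree_ramified_conjugate_iff[OF m]])
  moreover have "?h f \<in> U" if f: "f \<in> carrier subst_group" for f
  proof -
    have "?h fps_X = fps_X"
      using hom_one[OF ramified_conjugate_hom[OF m] group_subst_group group_subst_group] by simp
    moreover have "agree 1 fps_X f"
      using f by (auto simp: agree_def carrier_subst_group le_Suc_eq)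
    ultimately have "agree (Suc n * 1) fps_X (?h f)"
      using agree_ramified_conjugate_iff[OF m one_in_carrier f, of 1] by simp
    then have "agree n fps_X (?h f)" by (rule agree_mono) simp
    then show ?thesis using n[OF ramified_conjugate(1)[OF m f]] VU by blast
  qed
  ultimately show "\<exists>h. topological_group_embedding subst_group subst_topology subst_group subst_topology h \<and>
      h ` carrier subst_group \<subseteq> U" by blast
qed

end
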